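(* Let $p,N\ge 1$ be integers, let $H=[h_1,\dots,h_N]\in\mathbb{R}^{p\times N}$ and let $\alpha_1,\dots,\alpha_N>0$. The volume maximization problem $$\max_{V=[v_1,\dots,v_N]\in\mathbb{R}^{p\times N}:\ \|v_i\|_2^2\le\alpha_i\ \forall i}\ \ \sum_{\mathbb{I}\subseteq\{1,\dots,N\}}\mathrm{Volume}\big(\mathcal{P}(\{h_i+v_i\}_{i\in\mathbb{I}})\big)^2$$ is equivalent to the equality-constrained log-determinant problem $$\min_{V=[v_1,\dots,v_N]\in\mathbb{R}^{p\times N}:\ \|v_i\|_2^2=\alpha_i\ \forall i}\ \ \ell(V),\qquad \ell(V)=-\log\det\big[I+(H+V)^\top(H+V)\big],$$ i.e. a matrix $V\in\mathbb{R}^{p\times N}$ is an optimal solution of the first problem if and only if it is an optimal solution of the second (in particular, every optimal solution of the first problem satisfies $\|v_i\|_2^2=\alpha_i$ for all $i$).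
   Context: For a finite indexed family of vectors $w_1,\dots,w_n\in\mathbb{R}^p$, the parallelepiped they span is $\mathcal{P}(\{w_1,\dots,w_n\})=\{\sum_{i=1}^n\lambda_i w_i:\lambda\in[0,1]^n\}$. $\mathrm{Volume}(\mathcal{P}(\{w_1,\dots,w_n\}))$ denotes its $n$-dimensional volume (so it is $0$ if the $w_i$ are linearly dependent, in particular whenever $n>p$); for the empty family the volume is taken to be $1$. The sum ranges over all subsets $\mathbb{I}$ of the index set $\{1,\dots,N\}$. $I$ is the $N\times N$ identity matrix and $\|\cdot\|_2$ is the Euclidean norm. *)

theory Defs
  imports "HOL-Analysis.Analysis"
begin

definition parallelepiped :: "'i set \<Rightarrow> ('i \<Rightarrow> 'a::real_vector) \<Rightarrow> 'a set" where
  "parallelepiped I w = {\<Sum>i\<in>I. c i *\<^sub>R w i |c. \<forall>i\<in>I. 0 \<le> c i \<and> c i \<le> 1}"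

definition orthonormal_frame :: "nat \<Rightarrow> (nat \<Rightarrow> 'a::real_inner) \<Rightarrow> bool" where
  "orthonormal_frame n e \<longleftrightarrow> (\<forall>i<n. \<forall>j<n. e i \<bullet> e j = (if i = j then 1 else 0))"

text \<open>
  The \<open>n\<close>-dimensional volume of a set contained in some \<open>n\<close>-dimensional linear subspace is the
  Lebesgue measure on \<open>\<real>\<^sup>n\<close> (the product measure over \<open>{..<n}\<close>) of its coordinates with respect to
  an orthonormal basis of such a subspace; the choice of subspace and basis is immaterial. If \<open>n\<close>
  exceeds the dimension of the ambient space, every set is null for \<open>n\<close>-dimensional volume.
  The value is only meaningful for sets that do lie in a subspace of dimension at most \<open>n\<close> or
  when \<open>n\<close> exceeds the ambient dimension. This covers the parallelepiped of any \<open>n\<close> vectors.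
  For \<open>n = 0\<close>, the product measure is the unit point mass, so \<open>{0}\<close> has volume \<open>1\<close>.
\<close>
definition ndim_volume :: "nat \<Rightarrow> 'a::euclidean_space set \<Rightarrow> real" where
  "ndim_volume n S =
     (if n \<le> DIM('a) then
        let e = (SOME e. orthonormal_frame n e \<and> S \<subseteq> span (e ` {..<n}));
            M = (\<Pi>\<^sub>M i\<in>{..<n}. (lborel :: real measure))
        in measure M {x \<in> space M. (\<Sum>i<n. x i *\<^sub>R e i) \<in> S}
      else 0)"

text \<open>
  The vectors form an indexed family: the dimension is \<open>card I\<close>, counting repeated vectors.
\<close>
definition parallelepiped_volume :: "'i set \<Rightarrow> ('i \<Rightarrow> 'a::euclidean_space) \<Rightarrow> real" where
  "parallelepiped_volume I w = ndim_volume (card I) (parallelepiped I w)"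

definition volume_objective :: "real^'N^'p \<Rightarrow> real^'N^'p \<Rightarrow> real" where
  "volume_objective H V =
     (\<Sum>I\<in>Pow UNIV. (parallelepiped_volume I (\<lambda>i. column i H + column i V))\<^sup>2)"

definition neg_log_det :: "real^'N^'p \<Rightarrow> real^'N^'p \<Rightarrow> real" where
  "neg_log_det H V = - ln (det (mat 1 + transpose (H + V) ** (H + V)))"

end

theory Submission
  imports Defs
begin

text \<open>
  The squared volume of a parallelepiped is the Gram determinant of its edges, and
  \<open>det (I + W\<^sup>T W)\<close> is the sum of the principal minors of the Gram matrix \<open>W\<^sup>T W\<close>, so the volume
  objective equals \<open>det (I + (H + V)\<^sup>T (H + V))\<close>, whose negative logarithm is \<open>\<ell>\<close>.
  As a function of a single column, this is a positive constant times the squared distance of an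
  affinely varying point from a fixed subspace, hence strictly convex and quadratic. A column in the
  interior of its ball can therefore be moved to the sphere along its own line, in at least one of
  the two directions, with a strict gain. So maximizers over the balls lie on the spheres, and
  pushing the columns out one at a time shows that the maximum over the spheres is at least any
  value on the balls.
\<close>

section \<open>Gram determinants of indexed families\<close>

text \<open>
  The rows in \<open>I\<close> also contain the columns outside \<open>I\<close>; these entries do not affect the
  determinant, because the rows outside \<open>I\<close> are unit vectors.
\<close>

definition gram_mat :: "'n set \<Rightarrow> ('n \<Rightarrow> 'a::real_inner) \<Rightarrow> real^'n^'n" where
  "gram_mat I w = (\<chi> k. if k \<in> I then \<chi> l. w k \<bullet> w l else axis k 1)"

lemma det_gram_mat_empty [simp]: "det (gram_mat {} w) = 1"
proof -
  have "gram_mat {} w = mat 1"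
    by (simp add: gram_mat_def mat_def axis_def vec_eq_iff) 
  then show ?thesis by simp
qed

text \<open>Base times squared height: \<open>x\<close> is the component of \<open>w i\<close>
  orthogonal to the vectors in \<open>I\<close>, and row operations reduce row \<open>i\<close> to
  \<open>x \<bullet> x\<close> times a unit vector.\<close>

lemma det_gram_mat_insert:
  fixes w :: "'n::finite \<Rightarrow> 'a::real_inner"
  assumes i: "i \<notin> I"
    and span: "w i - x \<in> span (w ` I)"
    and orth: "\<And>j. j \<in> I \<Longrightarrow> x \<bullet> w j = 0"
  shows "det (gram_mat (insert i I) w) = (x \<bullet> x) * det (gram_mat I w)"
proof -
  let ?A = "(\<chi> k. if k = i then (x \<bullet> x) *s axis i 1 else row k (gram_mat I w)) :: real^'n^'n"
  let ?R = "{row j ?A | j. j \<noteq> i}"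
  \<comment> \<open>A Gram row depends linearly on its vector, so linear relations between vectors
    carry over to rows.\<close>
  define f :: "'a \<Rightarrow> real^'n" where "f u = (\<chi> l. u \<bullet> w l)" for u
  have "linear f"
    by (rule linearI) (simp_all add: f_def vec_eq_iff inner_add_left)
  have row_gram: "row k (gram_mat I w) = (if k \<in> I then f (w k) else axis k 1)" for k
    by (simp add: row_def gram_mat_def f_def vec_eq_iff)
  have rowA: "row k ?A = (if k \<in> I then f (w k) else axis k 1)" if "k \<noteq> i" for k
    using that by (simp add: row_gram [symmetric]) (simp add: row_def)
  have "f ` w ` I \<subseteq> ?R"
    using i rowA by (force simp: image_iff)
  then have 1: "f (w i - x) \<in> span ?R"
    using span span_mono linear_span_image [OF \<open>linear f\<close>, of "w ` I"] by blast
  have "x \<bullet> u = 0" if "u \<in> span (w ` I)" for u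
    using orthogonal_to_span [OF that, of x] orth unfolding orthogonal_def by blast
  from this [OF span] have xi: "x \<bullet> w i = x \<bullet> x"
    by (simp add: inner_diff_right)
  \<comment> \<open>Orthogonality clears the columns in \<open>I\<close>, \<open>xi\<close> gives
    the entry in column \<open>i\<close>, and the other columns are covered by the unit rows outside
    \<open>insert i I\<close>.\<close>
  have "f x - (x \<bullet> x) *s axis i 1 = (\<Sum>l\<in>- insert i I. (x \<bullet> w l) *\<^sub>R axis l 1)"
    using orth xi i
    by (auto simp: vec_eq_iff f_def axis_def if_distrib [of "\<lambda>a. _ * a"] sum.delta cong: if_cong)
  also have "\<dots> \<in> span ?R"
  proof (intro span_sum span_scale span_base)
    fix l assume "l \<in> - insert i I"
    then have "l \<noteq> i" "row l ?A = axis l 1"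
      using rowA by auto
    then show "axis l 1 \<in> ?R"
      by force
  qed
  finally have 2: "f x - (x \<bullet> x) *s axis i 1 \<in> span ?R" .
  have f_w: "f (w i) = f (w i - x) + (f x - (x \<bullet> x) *s axis i 1) + (x \<bullet> x) *s axis i 1"
    using linear_diff [OF \<open>linear f\<close>, of "w i" x] by simp
  define y where "y = f (w i - x) + (f x - (x \<bullet> x) *s axis i 1)"
  have y: "y \<in> span ?R"
    unfolding y_def using 1 2 by (rule span_add)
  have "det (gram_mat (insert i I) w) = det (\<chi> k. if k = i then row i ?A + y else row k ?A)"
  proof (rule arg_cong [where f = det], subst vec_eq_iff, rule allI)
    fix k
    have "row i ?A = (x \<bullet> x) *s axis i 1"
      by (simp add: row_def vec_eq_iff)
    then show "gram_mat (insert i I) w $ k = (\<chi> k. if k = i then row i ?A + y else row k ?A) $ k"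
      using i f_w rowA [of k] by (auto simp: gram_mat_def f_def y_def)
  qed
  also have "\<dots> = det ?A"
    using y by (intro det_row_span) (simp add: span_vec_eq)
  also have "\<dots> = (x \<bullet> x) * det (\<chi> k. if k = i then axis i 1 else row k (gram_mat I w))"
    by (rule det_row_mul)
  also have "(\<chi> k. if k = i then axis i 1 else row k (gram_mat I w)) = gram_mat I w"
    using i by (auto simp: vec_eq_iff gram_mat_def row_def)
  finally show ?thesis .
qed

text \<open>Both families have the same span at each stage of the induction, so the same orthogonal
  component \<open>z\<close> contributes the same factor on both sides. The index types may differ,
  which permits passing to a well-ordered one.\<close>

lemma det_gram_mat_reindex:
  fixes w :: "'n::finite \<Rightarrow> 'a::euclidean_space" and v :: "'m::finite \<Rightarrow> 'a"
  assumes "inj_on h I" "\<And>i. i \<in> I \<Longrightarrow> v (h i) = w i"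
  shows "det (gram_mat (h ` I) v) = det (gram_mat I w)"
  using finite [of I] assms
proof (induction I rule: finite_induct)
  case (insert i I)
  obtain y z where yz: "y \<in> span (w ` I)" "\<And>u. u \<in> span (w ` I) \<Longrightarrow> orthogonal z u" "w i = y + z"
    using orthogonal_subspace_decomp_exists by blast
  have z: "z \<bullet> w j = 0" if "j \<in> I" for j
    using that yz(2) by (auto simp: orthogonal_def intro: span_base)
  have im: "v ` h ` I = w ` I"
    using insert.prems by (force simp: image_iff)
  have 1: "det (gram_mat (insert i I) w) = (z \<bullet> z) * det (gram_mat I w)"
    using insert.hyps yz z by (intro det_gram_mat_insert) auto
  have 2: "det (gram_mat (insert (h i) (h ` I)) v) = (z \<bullet> z) * det (gram_mat (h ` I) v)"
    using insert.hyps insert.prems yz z by (intro det_gram_mat_insert) (auto simp: im)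
  show ?case
    using insert 1 2 by simp
qed simp

lemma det_gram_mat_cong:
  fixes w v :: "'n::finite \<Rightarrow> 'a::euclidean_space"
  assumes "\<And>i. i \<in> I \<Longrightarrow> v i = w i"
  shows "det (gram_mat I v) = det (gram_mat I w)"
  using det_gram_mat_reindex [of "\<lambda>i. i" I v w] assms by simp

text \<open>Some vector lies in the span of the others, so its height over them is zero.\<close>

lemma det_gram_mat_eq_0:
  fixes w :: "'n::finite \<Rightarrow> 'a::euclidean_space"
  assumes "card I > DIM('a)"
  shows "det (gram_mat I w) = 0"
proof -
  have "\<exists>i\<in>I. w i \<in> span (w ` (I - {i}))"
  proof (rule ccontr)
    assume *: "\<not> ?thesis"
    \<comment> \<open>A repeated vector would lie in the span of the others; hence the image of
      \<open>I\<close> has as many elements as \<open>I\<close>.\<close>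
    have inj: "inj_on w I"
      using * by (force intro!: inj_onI span_base)
    then have "w ` (I - {i}) = w ` I - {w i}" if "i \<in> I" for i
      using that by (auto simp: inj_on_def)
    with * have "independent (w ` I)"
      by (auto simp: dependent_def)
    then show False
      using independent_card_le assms card_image [OF inj] by fastforce
  qed
  then obtain i where i: "i \<in> I" "w i \<in> span (w ` (I - {i}))"
    by blast
  then show ?thesis
    using det_gram_mat_insert [of i "I - {i}" w 0] by (simp add: insert_absorb)
qed

section \<open>Expansion of \<open>det (I + W\<^sup>T W)\<close> into principal minors\<close>

text \<open>Multilinearity in the rows: \<open>I\<close> records where \<open>A\<close> is chosen
  over \<open>B\<close>. The induction needs arbitrary \<open>C\<close>, which absorbs the row that
  has just been split.\<close>

lemma det_add_rows:
  fixes A B C :: "'a::comm_ring_1^'n^'n"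
  shows "det (\<chi> k. if k \<in> S then A $ k + B $ k else C $ k) =
    (\<Sum>I\<in>Pow S. det (\<chi> k. if k \<in> S then if k \<in> I then A $ k else B $ k else C $ k))"
  using finite [of S]
proof (induction S arbitrary: C rule: finite_induct)
  case (insert i S)
  let ?D = "\<lambda>I. det (\<chi> k. if k \<in> insert i S then if k \<in> I then A $ k else B $ k else C $ k)"
  let ?X = "\<lambda>X. \<chi> k. if k = i then X $ k else C $ k"
  have "det (\<chi> k. if k \<in> insert i S then A $ k + B $ k else C $ k) =
    det (\<chi> k. if k = i then A $ k + B $ k else if k \<in> S then A $ k + B $ k else C $ k)"
    by (rule arg_cong [where f = det]) (simp add: vec_eq_iff)
  also have "\<dots> = det (\<chi> k. if k = i then A $ k else if k \<in> S then A $ k + B $ k else C $ k)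
      + det (\<chi> k. if k = i then B $ k else if k \<in> S then A $ k + B $ k else C $ k)"
    by (rule det_row_add)
  also have "\<dots> = det (\<chi> k. if k \<in> S then A $ k + B $ k else ?X A $ k)
      + det (\<chi> k. if k \<in> S then A $ k + B $ k else ?X B $ k)"
    using insert.hyps
    by (intro arg_cong2 [where f = "(+)"] arg_cong [where f = det]) (auto simp: vec_eq_iff)
  also have "\<dots> = (\<Sum>I\<in>Pow S. ?D (insert i I)) + (\<Sum>I\<in>Pow S. ?D I)"
    unfolding insert.IH using insert.hyps
    by (intro arg_cong2 [where f = "(+)"] sum.cong arg_cong [where f = det])
      (auto simp: vec_eq_iff)
  \<comment> \<open>Choosing \<open>A\<close> in row \<open>i\<close> gives the subsets that contain
    \<open>i\<close>, choosing \<open>B\<close> those that do not.\<close>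
  also have "(\<Sum>I\<in>Pow S. ?D (insert i I)) = (\<Sum>I\<in>insert i ` Pow S. ?D I)"
    using insert.hyps by (subst sum.reindex) (auto simp: inj_on_def o_def)
  also have "\<dots> + (\<Sum>I\<in>Pow S. ?D I) = (\<Sum>I\<in>Pow (insert i S). ?D I)"
    using insert.hyps unfolding Pow_insert
    by (subst add.commute, intro sum.union_disjoint [symmetric]) auto
  finally show ?case .
qed simp

lemma det_mat_1_plus_gram:
  fixes W :: "real^'n^'p"
  shows "det (mat 1 + transpose W ** W) = (\<Sum>I\<in>UNIV. det (gram_mat I (\<lambda>i. column i W)))"
    (is "det (mat 1 + ?G) = _")
proof -
  have G: "?G = (\<chi> k l. column k W \<bullet> column l W)"
    by (simp add: vec_eq_iff matrix_matrix_mult_def transpose_def column_def inner_vec_def)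
  have id: "mat 1 $ k = (axis k 1 :: real^'n)" for k
    by (simp add: vec_eq_iff mat_def axis_def)
  have "det (mat 1 + ?G) = det (\<chi> k. if k \<in> UNIV then ?G $ k + mat 1 $ k else 0 $ k)"
    by (rule arg_cong [where f = det]) (simp add: vec_eq_iff)
  also have "\<dots> = (\<Sum>I\<in>UNIV. det (gram_mat I (\<lambda>i. column i W)))"
    unfolding det_add_rows
    by (intro sum.cong arg_cong [where f = det]) (auto simp: gram_mat_def G id)
  finally show ?thesis .
qed

text \<open>The unit vectors contribute the identity matrix to the inner products. As a single Gram
  determinant, the expression can be factored by \<open>det_gram_mat_insert\<close> at any chosen
  column.\<close>

lemma det_mat_1_plus_gram_eq_gram:
  fixes W :: "real^'n^'p"
  shows "det (mat 1 + transpose W ** W) =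
    det (gram_mat UNIV (\<lambda>i. (axis i 1 :: real^'n, column i W)))"
  by (rule arg_cong [where f = det])
    (auto simp: vec_eq_iff gram_mat_def inner_prod_def inner_axis_axis mat_def
      matrix_matrix_mult_def transpose_def column_def inner_vec_def [of "vec_lambda _" "vec_lambda _"])

section \<open>Lebesgue measure of a parallelepiped in orthonormal coordinates\<close>

lemma borel_measurable_vec_lambda:
  fixes f :: "'a \<Rightarrow> 'm::finite \<Rightarrow> real"
  assumes "\<And>k. (\<lambda>x. f x k) \<in> borel_measurable M"
  shows "(\<lambda>x. \<chi> k. f x k) \<in> borel_measurable M"
  using assms
  by (subst borel_measurable_euclidean_space) (auto simp: Basis_vec_def inner_axis)

lemma measurable_merge_cart:
  fixes J :: "'m::finite set" and b :: "'m \<Rightarrow> 'i"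
  assumes b: "\<forall>k\<in>J. b k \<in> K"
  shows "(\<lambda>p. (\<chi> k. if k \<in> J then fst p (b k) else snd p k) :: real^'m)
    \<in> borel_measurable (PiM K (\<lambda>_. lborel) \<Otimes>\<^sub>M PiM (- J) (\<lambda>_. lborel))"
    (is "_ \<in> borel_measurable (?M1 \<Otimes>\<^sub>M ?M2)")
proof (rule borel_measurable_vec_lambda)
  fix k
  show "(\<lambda>p. if k \<in> J then fst p (b k) else snd p k) \<in> borel_measurable (?M1 \<Otimes>\<^sub>M ?M2)"
  proof (cases "k \<in> J")
    case True
    then have "b k \<in> K"
      using b by blast
    then have "(\<lambda>x. x (b k)) \<in> ?M1 \<rightarrow>\<^sub>M lborel"
      by (rule measurable_component_singleton)
    then show ?thesis
      using True by (auto intro: measurable_compose [OF measurable_fst])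
  next
    case False
    then have "(\<lambda>x. x k) \<in> ?M2 \<rightarrow>\<^sub>M lborel"
      by (intro measurable_component_singleton) simp
    then show ?thesis
      using False by (auto intro: measurable_compose [OF measurable_snd])
  qed
qed

text \<open>Lebesgue measure is determined by boxes, and the preimage of a box is a product of
  boxes. This links the product measure on functions in \<open>ndim_volume\<close> to the vector
  type, where images under linear maps can be measured.\<close>

lemma lborel_cart_eq_distr:
  fixes J :: "'m::finite set" and b :: "'m \<Rightarrow> 'i"
  assumes b: "bij_betw b J K"
  shows "(lborel :: (real^'m) measure) =
    distr (PiM K (\<lambda>_. lborel) \<Otimes>\<^sub>M PiM (- J) (\<lambda>_. lborel)) borel
      (\<lambda>p. \<chi> k. if k \<in> J then fst p (b k) else snd p k)"
    (is "_ = distr (?M1 \<Otimes>\<^sub>M ?M2) borel ?f")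
proof (rule lborel_eqI)
  have fin: "finite K"
    using b bij_betw_finite by fastforce
  interpret P: product_sigma_finite "\<lambda>_::'i. lborel :: real measure"
    by standard
  interpret Q: product_sigma_finite "\<lambda>_::'m. lborel :: real measure"
    by standard
  interpret S2: sigma_finite_measure ?M2
    by (rule Q.sigma_finite) simp
  have f: "?f \<in> borel_measurable (?M1 \<Otimes>\<^sub>M ?M2)"
    using bij_betwE [OF b] by (rule measurable_merge_cart)
  fix l u :: "real^'m"
  assume "\<And>a. a \<in> Basis \<Longrightarrow> l \<bullet> a \<le> u \<bullet> a"
  then have lu: "l $ k \<le> u $ k" for k
    by (metis axis_in_Basis_iff inner_axis inner_commute inner_real_def mult.right_neutral real_inner_1_right Basis_real_def singletonI)
  define c where "c = the_inv_into J b"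
  have c: "c (b k) = k" if "k \<in> J" for k
    using b that by (simp add: c_def bij_betw_def the_inv_into_f_f)
  let ?A = "\<lambda>k. {l $ k <..< u $ k}"
  have "?f -` box l u \<inter> space (?M1 \<Otimes>\<^sub>M ?M2) = PiE K (\<lambda>i. ?A (c i)) \<times> PiE (- J) ?A"
  proof -
    have "(\<forall>k. l $ k < (if k \<in> J then x (b k) else z k) \<and> (if k \<in> J then x (b k) else z k) < u $ k)
      \<longleftrightarrow> (\<forall>i\<in>K. x i \<in> ?A (c i)) \<and> (\<forall>k\<in>-J. z k \<in> ?A k)" for x z
    proof -
      have "(\<forall>i\<in>K. x i \<in> ?A (c i)) \<longleftrightarrow> (\<forall>k\<in>J. x (b k) \<in> ?A k)"
        using b c by (auto simp: bij_betw_def)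
      then show ?thesis
        by auto
    qed
    then show ?thesis
      by (auto simp: mem_box_cart space_pair_measure space_PiM PiE_def Pi_def)
  qed
  then have "emeasure (distr (?M1 \<Otimes>\<^sub>M ?M2) borel ?f) (box l u) =
    emeasure (?M1 \<Otimes>\<^sub>M ?M2) (PiE K (\<lambda>i. ?A (c i)) \<times> PiE (- J) ?A)"
    using f by (simp add: emeasure_distr)
  also have "\<dots> = emeasure ?M1 (PiE K (\<lambda>i. ?A (c i))) * emeasure ?M2 (PiE (- J) ?A)"
    by (intro S2.emeasure_pair_measure_Times sets_PiM_I_finite fin) auto
  also have "emeasure ?M1 (PiE K (\<lambda>i. ?A (c i))) = (\<Prod>i\<in>K. emeasure lborel (?A (c i)))"
    by (intro P.emeasure_PiM fin) auto
  also have "\<dots> = (\<Prod>k\<in>J. emeasure lborel (?A k))"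
    by (subst prod.reindex_bij_betw [OF b, symmetric]) (simp add: c)
  also have "emeasure ?M2 (PiE (- J) ?A) = (\<Prod>k\<in>-J. emeasure lborel (?A k))"
    by (intro Q.emeasure_PiM) auto
  also have "(\<Prod>k\<in>J. emeasure lborel (?A k)) * (\<Prod>k\<in>-J. emeasure lborel (?A k)) =
    (\<Prod>k\<in>UNIV. emeasure lborel (?A k))"
    by (subst prod.union_disjoint [symmetric]) auto
  also have "\<dots> = ennreal (\<Prod>k\<in>UNIV. u $ k - l $ k)"
    by (simp add: lu prod_ennreal)
  also have "(\<Prod>k\<in>UNIV. u $ k - l $ k) = (\<Prod>a\<in>Basis. (u - l) \<bullet> a)"
  proof -
    have "bij_betw (\<lambda>k. axis k (1::real)) UNIV (Basis :: (real^'m) set)"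
      by (auto simp: bij_betw_def inj_on_def axis_eq_axis Basis_vec_def)
    from prod.reindex_bij_betw [OF this, of "\<lambda>a. (u - l) \<bullet> a"] show ?thesis
      by (simp add: inner_axis)
  qed
  finally show "emeasure (distr (?M1 \<Otimes>\<^sub>M ?M2) borel ?f) (box l u) = ennreal (\<Prod>a\<in>Basis. (u - l) \<bullet> a)" .
qed simp

lemma compact_parallelepiped:
  fixes w :: "'n::finite \<Rightarrow> 'a::euclidean_space"
  shows "compact (parallelepiped I w)"
proof -
  have "linear (\<lambda>c::real^'n. \<Sum>i\<in>I. c $ i *\<^sub>R w i)"
    by (rule linearI) (simp_all add: scaleR_add_left sum.distrib scaleR_sum_right)
  moreover have "parallelepiped I w = (\<lambda>c::real^'n. \<Sum>i\<in>I. c $ i *\<^sub>R w i) ` cbox 0 1"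
  proof (intro equalityI subsetI)
    fix x assume "x \<in> parallelepiped I w"
    then obtain c where c: "x = (\<Sum>i\<in>I. c i *\<^sub>R w i)" "\<forall>i\<in>I. 0 \<le> c i \<and> c i \<le> 1"
      by (auto simp: parallelepiped_def)
    then show "x \<in> (\<lambda>c::real^'n. \<Sum>i\<in>I. c $ i *\<^sub>R w i) ` cbox 0 1"
      \<comment> \<open>Coefficients outside \<open>I\<close> are unconstrained; the default 0 keeps
        the point in the cube.\<close>
      by (intro image_eqI [of _ _ "\<chi> i. if i \<in> I then c i else 0"]) (auto simp: mem_box_cart)
  qed (auto simp: parallelepiped_def mem_box_cart)
  ultimately show ?thesis
    by (simp add: compact_continuous_image linear_continuous_on linear_conv_bounded_linear)
qed

text \<open>In coordinates the parallelepiped is the image of a cube under a matrix whose rows are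
  the edges. Its measure is the absolute determinant, and squaring gives the determinant of
  \<open>A ** transpose A\<close>, whose entries on \<open>J\<close> are the inner products of the
  edges.\<close>

lemma measure_coordinates_parallelepiped:
  fixes u :: "'m::{finite,wellorder} \<Rightarrow> 'a::euclidean_space"
  assumes e: "orthonormal_frame n e" and span: "parallelepiped J u \<subseteq> span (e ` {..<n})"
    and card: "card J = n"
  defines "M \<equiv> (\<Pi>\<^sub>M i\<in>{..<n}. (lborel :: real measure))"
  shows "(measure M {x \<in> space M. (\<Sum>i<n. x i *\<^sub>R e i) \<in> parallelepiped J u})\<^sup>2 =
    det (gram_mat J u)"
proof -
  obtain b where b: "bij_betw b J {..<n}"
    using card by (metis bij_betw_iff_card finite_class.finite_UNIV finite_lessThan card_lessThan finite)
  have b_less: "b k < n" if "k \<in> J" for k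
    using b that bij_betwE by blast
  \<comment> \<open>The coordinate matrix is padded to full size by unit vectors, which multiplies the
    parallelepiped by a unit cube and changes neither volume nor Gram determinant.\<close>
  define A :: "((real, 'm) vec, 'm) vec" where
    "A = (\<chi> k. if k \<in> J then \<chi> l. if l \<in> J then u k \<bullet> e (b l) else 0 else axis k 1)"
  \<comment> \<open>The assumption covers the edges too: each is the point of the parallelepiped
    with a single coefficient 1.\<close>
  have u_span: "u k \<in> span (e ` {..<n})" if "k \<in> J" for k
  proof -
    have "u k = (\<Sum>i\<in>J. (if i = k then 1 else 0) *\<^sub>R u i)"
      using that by (simp add: if_distrib [of "\<lambda>c. c *\<^sub>R _"] cong: if_cong)
    then have "u k \<in> parallelepiped J u"
      unfolding parallelepiped_def by (intro CollectI exI [of _ "\<lambda>i. if i = k then 1 else 0"]) auto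
    then show ?thesis
      using span by blast
  qed
  have e_inner: "(\<Sum>i<n. x i *\<^sub>R e i) \<bullet> e j = x j" if "j < n" for x j
  proof -
    have "(\<Sum>i<n. x i *\<^sub>R e i) \<bullet> e j = (\<Sum>i<n. if i = j then x i else 0)"
      unfolding inner_sum_left using e that
      by (intro sum.cong) (auto simp: orthonormal_frame_def)
    then show ?thesis
      using that by simp
  qed
  have expand: "y = (\<Sum>i<n. (y \<bullet> e i) *\<^sub>R e i)" if "y \<in> span (e ` {..<n})" for y
  proof -
    have inj: "inj_on e {..<n}"
      using e by (auto simp: inj_on_def orthonormal_frame_def) (metis zero_neq_one)
    have "y \<in> range (\<lambda>c. \<Sum>v\<in>e ` {..<n}. c v *\<^sub>R v)"
      using that by (simp add: span_finite)
    then obtain c where "y = (\<Sum>i<n. c (e i) *\<^sub>R e i)"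
      by (auto simp: sum.reindex [OF inj] o_def)
    then show ?thesis
      using e_inner [of _ "\<lambda>i. c (e i)"] by (auto intro!: sum.cong)
  qed
  have u_inner: "u k \<bullet> u l = (\<Sum>j\<in>J. (u k \<bullet> e (b j)) * (u l \<bullet> e (b j)))" if "k \<in> J" "l \<in> J" for k l
  proof -
    have "u k \<bullet> u l = u k \<bullet> (\<Sum>i<n. (u l \<bullet> e i) *\<^sub>R e i)"
      using expand [OF u_span [OF \<open>l \<in> J\<close>]] by simp
    also have "\<dots> = (\<Sum>i<n. (u k \<bullet> e i) * (u l \<bullet> e i))"
      by (simp add: inner_sum_right mult.commute)
    also have "\<dots> = (\<Sum>j\<in>J. (u k \<bullet> e (b j)) * (u l \<bullet> e (b j)))"
      by (rule sum.reindex_bij_betw [OF b, symmetric])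
    finally show ?thesis .
  qed
  define T where "T = (\<lambda>y. transpose A *v y) ` cbox 0 1"
  define P where "P = {x \<in> space M. (\<Sum>i<n. x i *\<^sub>R e i) \<in> parallelepiped J u}"
  define M2 where "M2 = (\<Pi>\<^sub>M k\<in>-J. (lborel :: real measure))"
  let ?f = "\<lambda>p. (\<chi> k. if k \<in> J then fst p (b k) else snd p k) :: (real, 'm) vec"
  have lin: "linear (\<lambda>y. transpose A *v y)"
    by (rule matrix_vector_mul_linear)
  have A_mult: "(transpose A *v y) $ l =
      (if l \<in> J then (\<Sum>k\<in>J. y $ k *\<^sub>R u k) \<bullet> e (b l) else y $ l)" for y l
  proof -
    have "(transpose A *v y) $ l = (\<Sum>k\<in>UNIV. A $ k $ l * y $ k)"
      by (simp add: matrix_vector_mult_def transpose_def)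
    also have "\<dots> = (\<Sum>k\<in>UNIV. if l \<in> J then if k \<in> J then y $ k * (u k \<bullet> e (b l)) else 0
        else if k = l then y $ l else 0)"
      by (intro sum.cong) (auto simp: A_def axis_def)
    also have "\<dots> = (if l \<in> J then (\<Sum>k\<in>J. y $ k *\<^sub>R u k) \<bullet> e (b l) else y $ l)"
      by (simp add: inner_sum_left sum.If_cases)
    finally show ?thesis .
  qed
  \<comment> \<open>Both vectors lie in the span of the frame, so they are equal iff all their
    coordinates agree.\<close>
  have mem_P: "x \<in> P \<longleftrightarrow> x \<in> space M \<and> (\<exists>c. (\<forall>k\<in>J. 0 \<le> c k \<and> c k \<le> 1) \<and>
      (\<forall>l\<in>J. x (b l) = (\<Sum>k\<in>J. c k *\<^sub>R u k) \<bullet> e (b l)))" for x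
  proof -
    have "(\<Sum>i<n. x i *\<^sub>R e i) = (\<Sum>k\<in>J. c k *\<^sub>R u k) \<longleftrightarrow>
        (\<forall>l\<in>J. x (b l) = (\<Sum>k\<in>J. c k *\<^sub>R u k) \<bullet> e (b l))" (is "_ = ?v \<longleftrightarrow> ?r") for c
    proof
      assume "(\<Sum>i<n. x i *\<^sub>R e i) = ?v"
      then show ?r
        using e_inner [of _ x, OF b_less] by simp
    next
      assume ?r
      moreover have "\<exists>l\<in>J. i = b l" if "i < n" for i
        using bij_betw_imp_surj_on [OF b] that by blast
      ultimately have "x i = ?v \<bullet> e i" if "i < n" for i
        using that by blast
      moreover have "?v = (\<Sum>i<n. (?v \<bullet> e i) *\<^sub>R e i)"
        by (intro expand span_sum span_scale u_span)
      ultimately show "(\<Sum>i<n. x i *\<^sub>R e i) = ?v"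
        by simp
    qed
    then show ?thesis
      by (auto simp: P_def parallelepiped_def)
  qed
  \<comment> \<open>The padded coordinates pass through \<open>transpose A\<close> unchanged, which
    makes the image a product with a unit cube.\<close>
  have vimage: "?f -` T \<inter> space (M \<Otimes>\<^sub>M M2) = P \<times> PiE (- J) (\<lambda>_. {0..1})"
  proof -
    have "?f (x, z) \<in> T \<longleftrightarrow> (\<exists>c. (\<forall>k\<in>J. 0 \<le> c k \<and> c k \<le> 1) \<and>
      (\<forall>l\<in>J. x (b l) = (\<Sum>k\<in>J. c k *\<^sub>R u k) \<bullet> e (b l))) \<and> (\<forall>k\<in>-J. z k \<in> {0..1})"
      (is "_ \<longleftrightarrow> (\<exists>c. ?c c) \<and> ?z") for x z
    proof
      assume "?f (x, z) \<in> T"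
      then obtain y where "y \<in> cbox 0 1" "?f (x, z) = transpose A *v y"
        by (auto simp: T_def)
      then have y: "0 \<le> y $ k \<and> y $ k \<le> 1"
        and fy: "?f (x, z) $ k = (transpose A *v y) $ k" for k
        by (simp_all add: mem_box_cart)
      have "x (b k) = (\<Sum>j\<in>J. y $ j *\<^sub>R u j) \<bullet> e (b k)" if "k \<in> J" for k
        using fy [of k] that by (simp add: A_mult del: transpose_matrix_vector)
      then have "?c (($) y)"
        using y by simp
      moreover have "z k = y $ k" if "k \<in> - J" for k
        using fy [of k] that by (simp add: A_mult del: transpose_matrix_vector)
      then have ?z
        using y by auto
      ultimately show "(\<exists>c. ?c c) \<and> ?z"
        by blast
    next
      assume "(\<exists>c. ?c c) \<and> ?z"
      then obtain c where c: "?c c" and z: ?z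
        by blast
      let ?y = "(\<chi> k. if k \<in> J then c k else z k) :: (real, 'm) vec"
      have "?f (x, z) = transpose A *v ?y"
        using c by (auto simp: vec_eq_iff A_mult simp del: transpose_matrix_vector)
      moreover have "?y \<in> cbox 0 1"
        using c z by (auto simp: mem_box_cart)
      ultimately show "?f (x, z) \<in> T"
        unfolding T_def by (rule image_eqI)
    qed
    then show ?thesis
      by (auto simp: space_pair_measure mem_P M2_def space_PiM PiE_def Pi_def)
  qed
  interpret Q: product_sigma_finite "\<lambda>_::'m. lborel :: real measure"
    by standard
  interpret S2: sigma_finite_measure M2
    unfolding M2_def by (rule Q.sigma_finite) simp
  have P_sets: "P \<in> sets M"
  proof -
    have "(\<lambda>x. x i) \<in> borel_measurable M" if "i \<in> {..<n}" for i
      unfolding M_def using measurable_component_singleton [OF that, of "\<lambda>_. lborel"] by simp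
    then have "(\<lambda>x. \<Sum>i<n. x i *\<^sub>R e i) \<in> borel_measurable M"
      by (intro borel_measurable_sum borel_measurable_scaleR) auto
    moreover have "parallelepiped J u \<in> sets borel"
      by (simp add: borel_compact compact_parallelepiped)
    ultimately have "(\<lambda>x. \<Sum>i<n. x i *\<^sub>R e i) -` parallelepiped J u \<inter> space M \<in> sets M"
      by (rule measurable_sets)
    also have "(\<lambda>x. \<Sum>i<n. x i *\<^sub>R e i) -` parallelepiped J u \<inter> space M = P"
      by (auto simp: P_def)
    finally show ?thesis .
  qed
  have "compact T"
    unfolding T_def by (intro compact_continuous_image linear_continuous_on compact_cbox) (use lin linear_conv_bounded_linear in blast)
  then have T_borel: "T \<in> sets borel"
    by (simp add: borel_compact)
  have "emeasure lborel T = emeasure (M \<Otimes>\<^sub>M M2) (P \<times> PiE (- J) (\<lambda>_. {0..1}))"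
  proof -
    have "?f \<in> borel_measurable (M \<Otimes>\<^sub>M M2)"
      unfolding M_def M2_def using bij_betwE [OF b] by (rule measurable_merge_cart)
    then have "emeasure (distr (M \<Otimes>\<^sub>M M2) borel ?f) T = emeasure (M \<Otimes>\<^sub>M M2) (P \<times> PiE (- J) (\<lambda>_. {0..1}))"
      using T_borel by (simp add: emeasure_distr vimage)
    then show ?thesis
      using lborel_cart_eq_distr [OF b] by (simp add: M_def M2_def)
  qed
  also have "\<dots> = emeasure M P * emeasure M2 (PiE (- J) (\<lambda>_. {0..1}))"
    using P_sets by (intro S2.emeasure_pair_measure_Times) (auto simp: M2_def intro: sets_PiM_I_finite)
  also have "emeasure M2 (PiE (- J) (\<lambda>_. {0..1})) = 1"
    unfolding M2_def by (subst Q.emeasure_PiM) auto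
  finally have "measure lborel T = measure M P"
    by (simp add: measure_def)
  moreover have "measure lborel T = measure lebesgue T"
    using T_borel by simp
  moreover have "measure lebesgue T = \<bar>det A\<bar>"
    unfolding T_def
    by (subst measure_linear_image [OF lin]) (auto simp: content_cbox_cart interval_eq_empty_cart simp del: transpose_matrix_vector)
  ultimately have "measure M P = \<bar>det A\<bar>"
    by simp
  then have "(measure M P)\<^sup>2 = det A * det (transpose A)"
    by (simp add: power2_eq_square)
  also have "\<dots> = det (A ** transpose A)"
    by (rule det_mul [symmetric])
  \<comment> \<open>Rows of \<open>A\<close> in \<open>J\<close> vanish outside \<open>J\<close>, so
    the product matches the Gram matrix with the vectors outside \<open>J\<close> set to
    zero.\<close>
  also have "A ** transpose A = gram_mat J (\<lambda>k. if k \<in> J then u k else 0)"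
  proof -
    have "(A ** transpose A) $ k $ l = gram_mat J (\<lambda>k. if k \<in> J then u k else 0) $ k $ l" for k l
    proof -
      have "(A ** transpose A) $ k $ l = (\<Sum>j\<in>UNIV. A $ k $ j * A $ l $ j)"
        by (simp add: matrix_matrix_mult_def transpose_def)
      also have "\<dots> = (\<Sum>j\<in>UNIV. if k \<in> J \<and> l \<in> J
          then if j \<in> J then (u k \<bullet> e (b j)) * (u l \<bullet> e (b j)) else 0
          else if j = k then if k \<notin> J \<and> k = l then 1 else 0 else 0)"
        by (intro sum.cong) (auto simp: A_def axis_def)
      also have "\<dots> = gram_mat J (\<lambda>k. if k \<in> J then u k else 0) $ k $ l"
        using u_inner by (auto simp: sum.If_cases gram_mat_def axis_def)
      finally show ?thesis .
    qed
    then show ?thesis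
      by (simp add: vec_eq_iff)
  qed
  also have "det \<dots> = det (gram_mat J u)"
    by (rule det_gram_mat_cong) simp
  finally show ?thesis
    by (simp add: P_def)
qed

section \<open>Squared volumes as Gram determinants\<close>

text \<open>A basis of \<open>S\<close> is enlarged to \<open>n\<close> vectors within a basis of
  the whole space and then orthonormalized. This ensures that the \<open>SOME\<close> in
  \<open>ndim_volume\<close> yields a genuine frame.\<close>

lemma orthonormal_frame_exists:
  fixes S :: "'a::euclidean_space set"
  assumes "dim S \<le> n" "n \<le> DIM('a)"
  shows "\<exists>e. orthonormal_frame n e \<and> S \<subseteq> span (e ` {..<n})"
proof -
  obtain B where B: "B \<subseteq> S" "independent B" "S \<subseteq> span B" "card B = dim S"
    using basis_exists [of S] by metis
  obtain C where C: "B \<subseteq> C" "independent C" "UNIV \<subseteq> span C"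
    using maximal_independent_subset_extend [OF subset_UNIV B(2)] by metis
  have "card C = DIM('a)"
    using basis_card_eq_dim [OF subset_UNIV C(3,2)] by simp
  moreover have "finite C"
    using C independent_imp_finite by blast
  ultimately obtain D where D: "B \<subseteq> D" "D \<subseteq> C" "card D = n"
    using exists_subset_between [of B n C] B C assms by auto
  have "dim (span D) = n"
    using D C(2) by (simp add: dim_eq_card_independent independent_mono)
  then obtain E where E: "pairwise orthogonal E" "\<And>x. x \<in> E \<Longrightarrow> norm x = 1"
      "independent E" "card E = n" "span E = span D"
    using orthonormal_basis_subspace [OF subspace_span, of D] by metis
  obtain e where e: "bij_betw e {..<n} E"
    using E independent_imp_finite ex_bij_betw_nat_finite by (metis atLeast0LessThan)
  have "orthonormal_frame n e"
    unfolding orthonormal_frame_def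
  proof (intro allI impI)
    fix i j assume ij: "i < n" "j < n"
    then have "e i \<in> E" "e j \<in> E" "e i = e j \<longleftrightarrow> i = j"
      using e by (auto simp: bij_betw_def inj_on_def)
    then show "e i \<bullet> e j = (if i = j then 1 else 0)"
      using E(1,2) by (auto simp: pairwise_def orthogonal_def norm_eq_1)
  qed
  moreover have "S \<subseteq> span (e ` {..<n})"
    using e E(5) B(3) D(1) span_mono by (metis bij_betw_imp_surj_on subset_trans)
  ultimately show ?thesis
    by blast
qed

lemma parallelepiped_volume_squared_wellorder:
  fixes u :: "'m::{finite,wellorder} \<Rightarrow> 'a::euclidean_space"
  shows "(parallelepiped_volume J u)\<^sup>2 = det (gram_mat J u)"
proof (cases "card J \<le> DIM('a)")
  case True
  let ?P = "parallelepiped J u"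
  have "?P \<subseteq> span (u ` J)"
    unfolding parallelepiped_def by (auto intro!: span_sum intro: span_scale span_base)
  then have "dim ?P \<le> card J"
    using dim_le_card [of ?P "u ` J"] card_image_le [of J u] by simp
  then have "\<exists>e. orthonormal_frame (card J) e \<and> ?P \<subseteq> span (e ` {..<card J})"
    using True by (rule orthonormal_frame_exists)
  \<comment> \<open>The coordinate formula holds for every admissible frame, hence for the one
    selected.\<close>
  from someI_ex [OF this]
  show ?thesis
    unfolding parallelepiped_volume_def ndim_volume_def Let_def if_P [OF True]
    by (elim conjE) (rule measure_coordinates_parallelepiped [OF _ _ refl])
next
  case False
  then show ?thesis
    by (simp add: parallelepiped_volume_def ndim_volume_def det_gram_mat_eq_0)
qed

text \<open>The library theorem \<open>measure_linear_image\<close> needs a well-ordered index type.\<close>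

typedef ('n::finite) numbered = "{..<CARD('n)}"
  using zero_less_card_finite by blast

instantiation numbered :: (finite) "{finite, wellorder}"
begin

definition less_eq_numbered :: "'a numbered \<Rightarrow> 'a numbered \<Rightarrow> bool" where
  "x \<le> y \<longleftrightarrow> Rep_numbered x \<le> Rep_numbered y"

definition less_numbered :: "'a numbered \<Rightarrow> 'a numbered \<Rightarrow> bool" where
  "x < y \<longleftrightarrow> Rep_numbered x < Rep_numbered y"

instance
proof
  show "finite (UNIV :: 'a numbered set)"
    using type_definition.univ [OF type_definition_numbered] by (metis finite_imageI finite_lessThan)
  fix P :: "'a numbered \<Rightarrow> bool" and a :: "'a numbered"
  assume *: "\<And>x. (\<And>y. y < x \<Longrightarrow> P y) \<Longrightarrow> P x"
  show "P a"
    by (induction a rule: measure_induct_rule [of Rep_numbered]) (auto intro: * simp: less_numbered_def)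
qed (auto simp: less_eq_numbered_def less_numbered_def Rep_numbered_inject)

end

lemma parallelepiped_volume_reindex:
  assumes "inj_on h I" "\<And>i. i \<in> I \<Longrightarrow> v (h i) = w i"
  shows "parallelepiped_volume (h ` I) v = parallelepiped_volume I w"
proof -
  have "parallelepiped (h ` I) v = parallelepiped I w"
  proof (intro equalityI subsetI)
    fix x assume "x \<in> parallelepiped I w"
    then obtain c where c: "x = (\<Sum>i\<in>I. c i *\<^sub>R w i)" "\<forall>i\<in>I. 0 \<le> c i \<and> c i \<le> 1"
      by (auto simp: parallelepiped_def)
    then show "x \<in> parallelepiped (h ` I) v"
      using assms unfolding parallelepiped_def
      by (intro CollectI exI [of _ "\<lambda>j. c (the_inv_into I h j)"])
        (auto simp: sum.reindex the_inv_into_f_f intro!: sum.cong)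
  next
    fix x assume "x \<in> parallelepiped (h ` I) v"
    then obtain c where "x = (\<Sum>j\<in>h ` I. c j *\<^sub>R v j)" "\<forall>j\<in>h ` I. 0 \<le> c j \<and> c j \<le> 1"
      by (auto simp: parallelepiped_def)
    then show "x \<in> parallelepiped I w"
      using assms unfolding parallelepiped_def
      by (intro CollectI exI [of _ "\<lambda>i. c (h i)"]) (auto simp: sum.reindex intro!: sum.cong)
  qed
  then show ?thesis
    using assms(1) by (simp add: parallelepiped_volume_def card_image)
qed

lemma parallelepiped_volume_squared:
  fixes w :: "'n::finite \<Rightarrow> 'a::euclidean_space"
  shows "(parallelepiped_volume I w)\<^sup>2 = det (gram_mat I w)"
proof -
  have "CARD('n numbered) = CARD('n)"
    using type_definition.card [OF type_definition_numbered] by simp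
  then obtain h :: "'n \<Rightarrow> 'n numbered" where "bij h"
    by (metis finite finite_same_card_bij)
  then have h: "inj_on h I" "\<And>i. w (inv h (h i)) = w i"
    by (auto simp: bij_def inj_def intro: inj_onI)
  show ?thesis
    using parallelepiped_volume_squared_wellorder [of "h ` I" "\<lambda>j. w (inv h j)"]
    using det_gram_mat_reindex [of h I "\<lambda>j. w (inv h j)" w] parallelepiped_volume_reindex [of h I "\<lambda>j. w (inv h j)" w] h
    by simp
qed

section \<open>The volume objective as a positive determinant\<close>

lemma det_gram_mat_nonneg:
  fixes w :: "'n::finite \<Rightarrow> 'a::euclidean_space"
  shows "0 \<le> det (gram_mat I w)"
  by (metis parallelepiped_volume_squared zero_le_power2)

lemma volume_objective_eq_det:
  fixes H V :: "real^'N^'p"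
  shows "volume_objective H V = det (mat 1 + transpose (H + V) ** (H + V))"
proof -
  have "column i (H + V) = column i H + column i V" for i
    by (simp add: column_def vec_eq_iff)
  then show ?thesis
    by (simp add: volume_objective_def det_mat_1_plus_gram parallelepiped_volume_squared)
qed

text \<open>The empty subset alone contributes 1. Positivity makes the logarithm strictly monotone
  on all values and keeps the Gram factor of the other columns nonzero.\<close>

lemma volume_objective_pos:
  fixes H V :: "real^'N^'p"
  shows "0 < volume_objective H V"
proof -
  have "1 = (parallelepiped_volume {} (\<lambda>i. column i H + column i V))\<^sup>2"
    by (simp add: parallelepiped_volume_squared)
  also have "\<dots> \<le> volume_objective H V"
    unfolding volume_objective_def by (rule member_le_sum) auto
  finally show ?thesis
    by simp
qed

lemma neg_log_det_eq: "neg_log_det H V = - ln (volume_objective H V)"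
  by (simp add: neg_log_det_def volume_objective_eq_det)

section \<open>Moving columns to their spheres\<close>

text \<open>Column \<open>i\<close> moves along its own line through the origin. The objective
  becomes a positive constant times the squared norm of \<open>z + t *\<^sub>R z'\<close>; its
  square term is positive, and the sign of \<open>t\<close> can be chosen to make the cross term
  nonnegative.\<close>

lemma exists_better_column:
  fixes H V :: "real^'N^'p"
  assumes "(norm (column i V))\<^sup>2 < a"
  shows "\<exists>V'. (\<forall>k. k \<noteq> i \<longrightarrow> column k V' = column k V) \<and> (norm (column i V'))\<^sup>2 = a \<and>
    volume_objective H V < volume_objective H V'"
proof -
  \<comment> \<open>Prefixing the unit vectors makes the family independent and its Gram matrix \<open>I + W\<^sup>T W\<close>.\<close>
  define u where "u X = (\<lambda>k. (axis k 1 :: real^'N, column k (H + X)))" for X :: "real^'N^'p"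
  define G where "G = det (gram_mat (UNIV - {i}) (u V))"
  define S where "S = u V ` (UNIV - {i})"
  have obj: "volume_objective H X = det (gram_mat (insert i (UNIV - {i})) (u X))" for X
    by (simp add: volume_objective_eq_det det_mat_1_plus_gram_eq_gram u_def insert_absorb)
  obtain b s where b: "column i V = s *\<^sub>R b" "norm b = 1"
  proof (cases "column i V = 0")
    case True
    show thesis
      \<comment> \<open>A zero column lies on every line through the origin, so any unit vector
        serves as direction.\<close>
      by (rule that [of 0 "axis undefined 1"]) (simp_all add: True norm_axis_1)
  next
    case False
    then show thesis
      by (intro that [of "norm (column i V)" "column i V /\<^sub>R norm (column i V)"]) auto
  qed
  with assms have "s\<^sup>2 < a"
    by simp
  then have "0 < a"
    using zero_le_power2 [of s] by linarith
  obtain y z where yz: "y \<in> span S" "\<And>x. x \<in> span S \<Longrightarrow> orthogonal z x" "u V i = y + z"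
    using orthogonal_subspace_decomp_exists by blast
  obtain y' z' where yz': "y' \<in> span S" "\<And>x. x \<in> span S \<Longrightarrow> orthogonal z' x" "(0, b) = y' + z'"
    using orthogonal_subspace_decomp_exists by blast
  \<comment> \<open>The map \<open>L\<close> sends \<open>p\<close> to \<open>snd p\<close> minus
    \<open>H + V\<close> applied to \<open>fst p\<close>. It kills every prefixed column but sends
    \<open>(0, b)\<close> to \<open>b\<close>, so \<open>(0, b)\<close> is outside the span.\<close>
  have "z' \<noteq> 0"
  proof
    assume "z' = 0"
    then have b_span: "(0, b) \<in> span S"
      using yz' by simp
    define L where "L p = snd p - (\<Sum>k\<in>UNIV. fst p $ k *\<^sub>R column k (H + V))"
      for p :: "(real^'N) \<times> (real^'p)"
    have "linear L"
      by (rule linearI) (simp_all add: L_def algebra_simps sum.distrib scaleR_sum_right)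
    moreover have "L p = 0" if "p \<in> S" for p
    proof -
      from that obtain k where p: "p = (axis k 1, column k (H + V))"
        unfolding S_def u_def by blast
      have "(\<Sum>j\<in>UNIV. axis k 1 $ j *\<^sub>R column j (H + V)) =
          (\<Sum>j\<in>UNIV. if j = k then column j (H + V) else 0)"
        by (intro sum.cong) (auto simp: axis_def)
      then show ?thesis
        by (simp add: L_def p)
    qed
    ultimately have "L (0, b) = 0"
      using b_span by (rule linear_eq_0_on_span)
    then show False
      using b(2) by (simp add: L_def)
  qed
  \<comment> \<open>The line meets the sphere at the parameters \<open>sqrt a\<close> and
    \<open>- sqrt a\<close>. The endpoint is selected by the sign of \<open>z \<bullet> z'\<close>;
    since \<open>s\<close> lies strictly between them, \<open>t\<close> has the sign of
    \<open>\<sigma>\<close>.\<close>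
  define \<sigma> :: real where "\<sigma> = (if z \<bullet> z' \<ge> 0 then 1 else - 1)"
  define t where "t = \<sigma> * sqrt a - s"
  have "\<bar>s\<bar> < sqrt a"
    using \<open>s\<^sup>2 < a\<close> real_less_rsqrt by (metis power2_abs)
  then have t: "t \<noteq> 0" "0 \<le> t * (z \<bullet> z')"
    by (auto simp: t_def \<sigma>_def mult_nonpos_nonpos)
  define V' where "V' = (\<chi> r k. if k = i then (\<sigma> * sqrt a) * b $ r else V $ r $ k)"
  have col: "column k V' = (if k = i then (\<sigma> * sqrt a) *\<^sub>R b else column k V)" for k
    by (simp add: V'_def column_def vec_eq_iff)
  have col_add: "column k (H + X) = column k H + column k X" for k and X :: "real^'N^'p"
    by (simp add: column_def vec_eq_iff)
  have u_other: "u V' k = u V k" if "k \<noteq> i" for k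
    using that by (simp add: u_def col_add col)
  have "u V' i = u V i + t *\<^sub>R (0, b)"
    by (simp add: u_def col_add col b(1) t_def algebra_simps)
  then have u_i: "u V' i = (y + t *\<^sub>R y') + (z + t *\<^sub>R z')"
    using yz(3) yz'(3) by (simp add: algebra_simps)
  have S': "u V' ` (UNIV - {i}) = S"
    unfolding S_def by (intro image_cong) (simp_all add: u_other)
  have G': "det (gram_mat (UNIV - {i}) (u V')) = G"
    unfolding G_def by (rule det_gram_mat_cong) (simp add: u_other)
  have u_S: "u V k \<in> span S" if "k \<noteq> i" for k
    using that by (auto simp: S_def intro: span_base)
  have V_eq: "volume_objective H V = (z \<bullet> z) * G"
    unfolding obj G_def
  proof (rule det_gram_mat_insert)
    show "u V i - z \<in> span (u V ` (UNIV - {i}))"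
      using yz(1,3) by (simp add: S_def)
  qed (use yz(2) u_S in \<open>auto simp: orthogonal_def\<close>)
  have V'_eq: "volume_objective H V' = ((z + t *\<^sub>R z') \<bullet> (z + t *\<^sub>R z')) * G"
    unfolding obj G' [symmetric]
  proof (rule det_gram_mat_insert)
    show "u V' i - (z + t *\<^sub>R z') \<in> span (u V' ` (UNIV - {i}))"
      unfolding u_i S' using yz(1) yz'(1) by (simp add: span_add span_scale)
  qed (use yz(2) yz'(2) u_S u_other in \<open>auto simp: orthogonal_def inner_add_left\<close>)
  have "G \<ge> 0"
    unfolding G_def by (rule det_gram_mat_nonneg)
  moreover have "G \<noteq> 0"
    using V_eq volume_objective_pos [of H V] by auto
  ultimately have "0 < G"
    by simp
  have "(z + t *\<^sub>R z') \<bullet> (z + t *\<^sub>R z') = z \<bullet> z + 2 * (t * (z \<bullet> z')) + t\<^sup>2 * (z' \<bullet> z')"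
    by (simp add: inner_add_left inner_add_right inner_commute power2_eq_square algebra_simps)
  moreover have "0 < t\<^sup>2 * (z' \<bullet> z')"
    using t(1) \<open>z' \<noteq> 0\<close> by simp
  ultimately have "z \<bullet> z < (z + t *\<^sub>R z') \<bullet> (z + t *\<^sub>R z')"
    using t(2) by linarith
  then have "volume_objective H V < volume_objective H V'"
    unfolding V_eq V'_eq using \<open>0 < G\<close> by simp
  moreover have "(norm (column i V'))\<^sup>2 = a"
    using b(2) \<open>0 < a\<close> by (simp add: col power_mult_distrib \<sigma>_def)
  ultimately show ?thesis
    using col by (intro exI [of _ V']) auto
qed

text \<open>Induction on the number of columns off their spheres: each move settles one column,
  leaves the others fixed and does not lower the objective.\<close>

lemma exists_better_on_spheres:
  fixes H V :: "real^'N^'p"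
  assumes "\<And>i. (norm (column i V))\<^sup>2 \<le> \<alpha> i"
  shows "\<exists>U. (\<forall>i. (norm (column i U))\<^sup>2 = \<alpha> i) \<and> volume_objective H V \<le> volume_objective H U"
  using assms
proof (induction "card {i. (norm (column i V))\<^sup>2 \<noteq> \<alpha> i}" arbitrary: V rule: less_induct)
  case less
  show ?case
  proof (cases "\<exists>i. (norm (column i V))\<^sup>2 \<noteq> \<alpha> i")
    case True
    then obtain i where i: "(norm (column i V))\<^sup>2 \<noteq> \<alpha> i"
      by blast
    then have "(norm (column i V))\<^sup>2 < \<alpha> i"
      using less.prems [of i] by simp
    from exists_better_column [OF this, of H] obtain V' where V':
        "\<And>k. k \<noteq> i \<Longrightarrow> column k V' = column k V" "(norm (column i V'))\<^sup>2 = \<alpha> i"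
        "volume_objective H V < volume_objective H V'"
      by blast
    have "(norm (column k V'))\<^sup>2 \<le> \<alpha> k" for k
      using V'(1,2) less.prems by (cases "k = i") auto
    moreover have "{k. (norm (column k V'))\<^sup>2 \<noteq> \<alpha> k} \<subset> {k. (norm (column k V))\<^sup>2 \<noteq> \<alpha> k}"
      using i V'(1,2) by (auto, metis)
    then have "card {k. (norm (column k V'))\<^sup>2 \<noteq> \<alpha> k} < card {k. (norm (column k V))\<^sup>2 \<noteq> \<alpha> k}"
      by (intro psubset_card_mono) auto
    ultimately obtain U where "\<forall>i. (norm (column i U))\<^sup>2 = \<alpha> i"
        "volume_objective H V' \<le> volume_objective H U"
      using less.hyps by blast
    then show ?thesis
      using V'(3) by (intro exI [of _ U]) simp
  qed auto
qed

section \<open>Equivalence of the two optimization problems\<close>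

theorem proposition4:
  fixes H :: "real^'N^'p" and \<alpha> :: "'N \<Rightarrow> real"
  assumes "\<And>i. \<alpha> i > 0"
  shows "(\<forall>V. is_arg_max (volume_objective H) (\<lambda>V. \<forall>i. (norm (column i V))\<^sup>2 \<le> \<alpha> i) V \<longleftrightarrow>
              is_arg_min (neg_log_det H) (\<lambda>V. \<forall>i. (norm (column i V))\<^sup>2 = \<alpha> i) V) \<and>
         (\<forall>V. is_arg_max (volume_objective H) (\<lambda>V. \<forall>i. (norm (column i V))\<^sup>2 \<le> \<alpha> i) V \<longrightarrow>
              (\<forall>i. (norm (column i V))\<^sup>2 = \<alpha> i))"
proof -
  let ?ball = "\<lambda>V::real^'N^'p. \<forall>i. (norm (column i V))\<^sup>2 \<le> \<alpha> i"
  let ?sphere = "\<lambda>V::real^'N^'p. \<forall>i. (norm (column i V))\<^sup>2 = \<alpha> i"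
  have log: "neg_log_det H X < neg_log_det H Y \<longleftrightarrow> volume_objective H Y < volume_objective H X" for X Y
    by (simp add: neg_log_det_eq volume_objective_pos)
  have on_sphere: "?sphere V" if max: "is_arg_max (volume_objective H) ?ball V" for V
  proof (rule ccontr)
    assume "\<not> ?sphere V"
    then obtain i where i: "(norm (column i V))\<^sup>2 < \<alpha> i"
      using max unfolding is_arg_max_def by (metis order_le_less)
    from exists_better_column [OF this, of H] obtain V' where V':
        "\<And>k. k \<noteq> i \<Longrightarrow> column k V' = column k V" "(norm (column i V'))\<^sup>2 = \<alpha> i"
        "volume_objective H V < volume_objective H V'"
      by blast
    have "?ball V'"
      using V'(1,2) max unfolding is_arg_max_def by (metis order_refl)
    then show False
      using max V'(3) unfolding is_arg_max_def by blast
  qed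
  \<comment> \<open>The spheres lie inside the balls, so a maximizer over the balls that lies on the
    spheres is also optimal there.\<close>
  have "is_arg_min (neg_log_det H) ?sphere V" if max: "is_arg_max (volume_objective H) ?ball V" for V
    using max on_sphere [OF max] unfolding is_arg_min_def is_arg_max_def log by (metis order_refl)
  moreover have "is_arg_max (volume_objective H) ?ball V" if min: "is_arg_min (neg_log_det H) ?sphere V" for V
    unfolding is_arg_max_def
  proof (intro conjI notI)
    show "?ball V"
      using min by (simp add: is_arg_min_def)
    assume "\<exists>Y. ?ball Y \<and> volume_objective H V < volume_objective H Y"
    then obtain Y where Y: "?ball Y" "volume_objective H V < volume_objective H Y"
      by blast
    \<comment> \<open>A better competitor in the balls is pushed to the spheres without loss, where
      it would beat the minimizer.\<close>
    then obtain U where "?sphere U" "volume_objective H Y \<le> volume_objective H U"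
      using exists_better_on_spheres [of Y \<alpha> H] by blast
    then show False
      using min Y(2) unfolding is_arg_min_def log by fastforce
  qed
  ultimately show ?thesis
    using on_sphere by blast
qed

end
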